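(* For each positive integer $n$ let $d=d_n=(n-1)^2+1$, and let $\mathcal S_n$ be a uniformly random $d$-element subset of the set $\mathcal P_n$ of all $n\times n$ permutation matrices. Then, as $n\to\infty$, $$\Pr(\mathcal S_n\text{ is linearly dependent over }\mathbb R)\ \ge\ \exp(3/2+o(1))\,n^2e^{-n}.$$ More precisely, the probability that there is at least one matrix position $(i,j)\in\{1,\dots,n\}^2$ that is unoccupied by every member of $\mathcal S_n$ is $$(1+o(1))\,n^2\left(1-\frac1n\right)^d=\exp(3/2+o(1))\,n^2e^{-n}.$$
   Context: A position $(i,j)$ is occupied by a permutation matrix $P$ if $P_{ij}=1$, and unoccupied by it if $P_{ij}=0$. The $o(1)$ terms are as $n\to\infty$. *)

theory Defs
  imports
    "HOL-Probability.Probability"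
    "HOL-Combinatorics.Permutations"
    "Jordan_Normal_Form.VS_Connect"
begin

text \<open>Rows and columns are indexed by \<open>{0..<n}\<close>, as usual for the type \<^typ>\<open>real mat\<close>,
  rather than by \<open>{1..n}\<close>.\<close>

definition perm_mat :: "nat \<Rightarrow> (nat \<Rightarrow> nat) \<Rightarrow> real mat" where
  "perm_mat n \<sigma> = mat n n (\<lambda>(i, j). if j = \<sigma> i then 1 else 0)"

definition perm_mats :: "nat \<Rightarrow> real mat set" where
  "perm_mats n = perm_mat n ` {\<sigma>. \<sigma> permutes {0..<n}}"

definition num_mats :: "nat \<Rightarrow> nat" where
  "num_mats n = (n - 1)\<^sup>2 + 1"

definition random_perm_mats :: "nat \<Rightarrow> real mat set pmf" where
  "random_perm_mats n = pmf_of_set {S. S \<subseteq> perm_mats n \<and> card S = num_mats n}"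

definition lin_dependent_mats :: "nat \<Rightarrow> real mat set \<Rightarrow> bool" where
  "lin_dependent_mats n S \<longleftrightarrow>
     LinearCombinations.module.lin_dep class_ring (module_mat TYPE(real) n n) S"

definition unoccupied :: "real mat \<Rightarrow> nat \<Rightarrow> nat \<Rightarrow> bool" where
  "unoccupied P i j \<longleftrightarrow> P $$ (i, j) = 0"

definition has_unoccupied_position :: "nat \<Rightarrow> real mat set \<Rightarrow> bool" where
  "has_unoccupied_position n S \<longleftrightarrow>
     (\<exists>i\<in>{0..<n}. \<exists>j\<in>{0..<n}. \<forall>P\<in>S. unoccupied P i j)"

lemma inj_on_perm_mat: "inj_on (perm_mat n) {\<sigma>. \<sigma> permutes {0..<n}}"
proof (rule inj_onI, clarsimp, rule ext)
  fix \<sigma> \<tau> i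
  assume \<sigma>: "\<sigma> permutes {0..<n}" and \<tau>: "\<tau> permutes {0..<n}"
    and eq: "perm_mat n \<sigma> = perm_mat n \<tau>"
  show "\<sigma> i = \<tau> i"
  proof (cases "i < n")
    case True
    then have j: "\<sigma> i < n" using permutes_in_image[OF \<sigma>, of i] by simp
    from eq have "perm_mat n \<sigma> $$ (i, \<sigma> i) = perm_mat n \<tau> $$ (i, \<sigma> i)" by simp
    then show ?thesis using True j by (simp add: perm_mat_def split: if_splits)
  next
    case False
    then show ?thesis using permutes_not_in[OF \<sigma>, of i] permutes_not_in[OF \<tau>, of i] by simp
  qed
qed

lemma card_perm_mats: "card (perm_mats n) = fact n"
  unfolding perm_mats_def by (simp add: card_image[OF inj_on_perm_mat] card_permutations)

lemma finite_perm_mats: "finite (perm_mats n)"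
  unfolding perm_mats_def by (simp add: finite_permutations)

lemma num_mats_le: "num_mats n \<le> fact n"
proof (cases n)
  case (Suc m)
  have "m ^ 2 + 1 \<le> Suc m * fact m"
  proof (cases "m = 0")
    case False
    then have "m ^ 2 + 1 \<le> Suc m * m" by (simp add: power2_eq_square)
    also have "\<dots> \<le> Suc m * fact m" by (rule mult_le_mono2) (rule fact_ge_self)
    finally show ?thesis .
  qed simp
  then show ?thesis using Suc by (simp add: num_mats_def)
qed (simp add: num_mats_def)

text \<open>The random set is therefore uniform on a nonempty finite sample space.\<close>

lemma set_pmf_random_perm_mats:
  "set_pmf (random_perm_mats n) = {S. S \<subseteq> perm_mats n \<and> card S = num_mats n}"
  unfolding random_perm_mats_def
proof (rule set_pmf_of_set)
  show "finite {S. S \<subseteq> perm_mats n \<and> card S = num_mats n}"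
    using finite_perm_mats by simp
  show "{S. S \<subseteq> perm_mats n \<and> card S = num_mats n} \<noteq> {}"
    using obtain_subset_with_card_n[of "num_mats n" "perm_mats n"] num_mats_le
    by (metis (mono_tags, lifting) card_perm_mats empty_Collect_eq)
qed

end

theory Submission
  imports Defs "HOL-Real_Asymp.Real_Asymp"
begin

text \<open>
  Write \<open>d = (n - 1)\<^sup>2 + 1\<close>. A fixed position is avoided by a fraction \<open>1 - 1/n\<close> of the \<open>n!\<close>
  permutation matrices, and two distinct positions are avoided simultaneously by a fraction of at most
  \<open>(1 - 1/n) (1 - (n - 2)/(n - 1)\<^sup>2)\<close>. If \<open>m\<close> of the \<open>N = n!\<close> matrices have some property, then all
  \<open>d\<close> members of the random set have it with probability \<open>(m choose d) / (N choose d)\<close>. This is at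
  most \<open>(m/N)\<^sup>d\<close>, and at least \<open>(m/N)\<^sup>d (1 - d\<^sup>2/m)\<close>: as \<open>d\<^sup>2\<close> is negligible against \<open>n!\<close>, it makes
  hardly any difference that the matrices are drawn without replacement
  (\<open>binomial_ratio_le_power\<close>, \<open>binomial_ratio_ge\<close>).

  The union bound over the \<open>n\<^sup>2\<close> positions bounds the probability of an unoccupied position by
  \<open>n\<^sup>2 (1 - 1/n)\<^sup>d\<close>. In the Bonferroni lower bound (\<open>bonferroni_lower_bound\<close>) the at most \<open>n\<^sup>4\<close>
  pairs of positions contribute \<open>n\<^sup>4 (1 - 1/n)\<^sup>d e\<^bsup>2 - n\<^esup>\<close> at most, which is of smaller order, so the two
  bounds agree asymptotically (\<open>prob_over_main_term_tendsto\<close>). The form \<open>exp (3/2 + o(1)) n\<^sup>2 e\<^bsup>-n\<^esup>\<close>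
  comes from expanding \<open>d ln (1 - 1/n)\<close>.

  For \<open>n \<ge> 3\<close>, an unoccupied position \<open>(i, j)\<close> forces linear dependence
  (\<open>lin_dependent_mats_if_has_unoccupied_position\<close>): the \<open>(n - 1)\<^sup>2\<close> equations saying that the entries
  outside row \<open>i\<close> and column \<open>j\<close> of a combination vanish have a nontrivial solution in \<open>d\<close> unknowns, and
  since the combination has constant line sums and a zero at \<open>(i, j)\<close>, it vanishes altogether.
\<close>

section \<open>Unoccupied positions force linear dependence\<close>

lemma homogeneous_system_nontrivial_solution:
  fixes M :: "'k \<Rightarrow> 's \<Rightarrow> 'a::field"
  assumes "finite K" "finite S" "card K < card S"
  shows "\<exists>a. (\<exists>s\<in>S. a s \<noteq> 0) \<and> (\<forall>k\<in>K. (\<Sum>s\<in>S. a s * M k s) = 0)"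
  using assms
proof (induction K arbitrary: S M rule: finite_induct)
  case empty
  then have "S \<noteq> {}" by auto
  then show ?case by (intro exI[of _ "\<lambda>_. 1"]) auto
next
  case (insert k K)
  show ?case
  proof (cases "\<forall>s\<in>S. M k s = 0")
    case True
    have "card K < card S" using insert by simp
    then obtain a where "\<exists>s\<in>S. a s \<noteq> 0" "\<forall>k\<in>K. (\<Sum>s\<in>S. a s * M k s) = 0"
      using insert.IH[of S M] insert.prems by blast
    then show ?thesis using True by (intro exI[of _ a]) auto
  next
    case False
    then obtain t where t: "t \<in> S" "M k t \<noteq> 0" by blast
    \<comment> \<open>The equation \<open>k\<close> is used to eliminate the unknown \<open>t\<close>.\<close>
    define M' where "M' l s = M l s - M l t * M k s / M k t" for l s
    have "card K < card (S - {t})" using insert t by simp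
    then obtain a where a: "\<exists>s\<in>S - {t}. a s \<noteq> 0"
        and eqs: "\<forall>l\<in>K. (\<Sum>s\<in>S - {t}. a s * M' l s) = 0"
      using insert.IH[of "S - {t}" M'] insert.prems by blast
    define r where "r = (\<Sum>s\<in>S - {t}. a s * M k s)"
    define b where "b = a(t := - r / M k t)"
    have sum_b: "(\<Sum>s\<in>S. b s * M l s) = - r / M k t * M l t + (\<Sum>s\<in>S - {t}. a s * M l s)" for l
      using t insert.prems by (subst sum.remove[of S t]) (auto simp: b_def intro!: sum.cong)
    have "(\<Sum>s\<in>S. b s * M k s) = 0"
      using t by (simp add: sum_b r_def)
    moreover have "(\<Sum>s\<in>S. b s * M l s) = 0" if "l \<in> K" for l
    proof -
      have "0 = (\<Sum>s\<in>S - {t}. a s * M' l s)" using eqs that by simp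
      also have "\<dots> = (\<Sum>s\<in>S - {t}. a s * M l s) - (\<Sum>s\<in>S - {t}. M l t / M k t * (a s * M k s))"
        by (simp add: M'_def sum_subtractf algebra_simps)
      also have "\<dots> = (\<Sum>s\<in>S - {t}. a s * M l s) - M l t / M k t * r"
        by (simp add: r_def sum_distrib_left)
      finally show ?thesis by (simp add: sum_b)
    qed
    moreover have "\<exists>s\<in>S. b s \<noteq> 0" using a by (auto simp: b_def)
    ultimately show ?thesis by blast
  qed
qed

lemma lin_dependent_matsI:
  assumes "finite S" "S \<subseteq> carrier_mat n n" "P \<in> S" "a P \<noteq> 0"
    and zero: "\<And>r c. r < n \<Longrightarrow> c < n \<Longrightarrow> (\<Sum>Q\<in>S. a Q * Q $$ (r, c)) = 0"
  shows "lin_dependent_mats n S"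
proof -
  interpret V: matrix_vs n n "TYPE(real)" .
  have closed: "V.lincomb a T \<in> carrier_mat n n" if "T \<subseteq> carrier_mat n n" for T
    using V.lincomb_closed[of T a] that by simp
  have entries: "V.lincomb a T $$ (r, c) = (\<Sum>Q\<in>T. a Q * Q $$ (r, c))"
    if "finite T" "T \<subseteq> carrier_mat n n" "r < n" "c < n" for T r c
    using that
  proof (induction T rule: finite_induct)
    case empty
    then show ?case by (simp add: V.lincomb_def module_mat_simps)
  next
    case (insert Q T)
    then have "V.lincomb a (insert Q T) = a Q \<cdot>\<^sub>m Q + V.lincomb a T"
      using V.lincomb_insert2[of T a Q] by simp
    moreover have "dim_row (V.lincomb a T) = n" "dim_col (V.lincomb a T) = n"
      using carrier_matD[OF closed[of T]] insert by auto
    ultimately show ?case using insert by auto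
  qed
  have "V.lincomb a S = 0\<^sub>m n n"
    using assms carrier_matD[OF closed[of S]] entries[of S] by (intro eq_matI) auto
  then have "V.lin_dep S"
    unfolding V.lin_dep_def using assms by auto
  then show ?thesis by (simp add: lin_dependent_mats_def)
qed

lemma perm_mat_row_sum:
  assumes "\<sigma> permutes {0..<n}" "r < n"
  shows "(\<Sum>c\<in>{0..<n}. perm_mat n \<sigma> $$ (r, c)) = 1"
proof -
  have "\<sigma> r < n" using permutes_in_image[OF assms(1), of r] assms(2) by simp
  have "(\<Sum>c\<in>{0..<n}. perm_mat n \<sigma> $$ (r, c)) = (\<Sum>c\<in>{0..<n}. if c = \<sigma> r then 1 else 0)"
    using assms by (intro sum.cong) (auto simp: perm_mat_def)
  then show ?thesis using \<open>\<sigma> r < n\<close> by simp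
qed

lemma perm_mat_col_sum:
  assumes "\<sigma> permutes {0..<n}" "c < n"
  shows "(\<Sum>r\<in>{0..<n}. perm_mat n \<sigma> $$ (r, c)) = 1"
proof -
  have "(\<Sum>r\<in>{0..<n}. perm_mat n \<sigma> $$ (r, c))
      = (\<Sum>r\<in>{0..<n}. ((\<lambda>k. if c = k then 1 else 0) \<circ> \<sigma>) r)"
    using assms by (intro sum.cong) (auto simp: perm_mat_def)
  also have "\<dots> = (\<Sum>k\<in>{0..<n}. if c = k then 1 else 0)"
    using sum.permute[OF assms(1)] by metis
  finally show ?thesis using assms by simp
qed

text \<open>A matrix whose row and column sums all equal \<open>s\<close> and whose entry at \<open>(i, j)\<close> is zero is
  determined by its entries outside row \<open>i\<close> and column \<open>j\<close>. When those vanish, every other entry of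
  row \<open>i\<close> and column \<open>j\<close> equals \<open>s\<close>, so column \<open>j\<close> yields \<open>s = (n - 1) s\<close>; this needs \<open>n \<noteq> 2\<close>.\<close>

lemma constant_line_sums_eq_zero:
  fixes B :: "nat \<Rightarrow> nat \<Rightarrow> real"
  assumes n: "n \<ge> 3" and ij: "i < n" "j < n"
    and rows: "\<And>r. r < n \<Longrightarrow> (\<Sum>c\<in>{0..<n}. B r c) = s"
    and cols: "\<And>c. c < n \<Longrightarrow> (\<Sum>r\<in>{0..<n}. B r c) = s"
    and corner: "B i j = 0"
    and minor: "\<And>r c. r < n \<Longrightarrow> c < n \<Longrightarrow> r \<noteq> i \<Longrightarrow> c \<noteq> j \<Longrightarrow> B r c = 0"
    and rc: "r < n" "c < n"
  shows "B r c = 0"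
proof -
  have col_j: "B r j = s" if "r < n" "r \<noteq> i" for r
  proof -
    have "s = B r j + (\<Sum>c\<in>{0..<n} - {j}. B r c)"
      using rows[OF that(1)] ij sum.remove[of "{0..<n}" j "B r"] by simp
    also have "(\<Sum>c\<in>{0..<n} - {j}. B r c) = 0"
      using minor that by (intro sum.neutral) auto
    finally show ?thesis by simp
  qed
  have row_i: "B i c = s" if "c < n" "c \<noteq> j" for c
  proof -
    have "s = B i c + (\<Sum>r\<in>{0..<n} - {i}. B r c)"
      using cols[OF that(1)] ij sum.remove[of "{0..<n}" i "\<lambda>r. B r c"] by simp
    also have "(\<Sum>r\<in>{0..<n} - {i}. B r c) = 0"
      using minor that by (intro sum.neutral) auto
    finally show ?thesis by simp
  qed
  have "s = B i j + (\<Sum>r\<in>{0..<n} - {i}. B r j)"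
    using cols[OF ij(2)] ij sum.remove[of "{0..<n}" i "\<lambda>r. B r j"] by simp
  also have "(\<Sum>r\<in>{0..<n} - {i}. B r j) = (\<Sum>r\<in>{0..<n} - {i}. s)"
    using col_j by (intro sum.cong) auto
  also have "\<dots> = (real n - 1) * s"
    using ij n by (simp add: of_nat_diff)
  finally have "(real n - 2) * s = 0" using corner by (simp add: algebra_simps)
  then have "s = 0" using n by simp
  then show ?thesis using rc corner minor col_j row_i by metis
qed

lemma lin_dependent_mats_if_has_unoccupied_position:
  assumes "n \<ge> 3" "S \<subseteq> perm_mats n" "card S = num_mats n" "has_unoccupied_position n S"
  shows "lin_dependent_mats n S"
proof -
  obtain i j where ij: "i < n" "j < n" and un: "\<forall>P\<in>S. P $$ (i, j) = 0"
    using assms(4) by (auto simp: has_unoccupied_position_def unoccupied_def)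
  have fin: "finite S" using assms(2) finite_perm_mats finite_subset by blast
  define K where "K = ({0..<n} - {i}) \<times> ({0..<n} - {j})"
  have "card K < card S"
    using ij assms(3) by (simp add: K_def card_cartesian_product num_mats_def power2_eq_square)
  then obtain a where "\<exists>P\<in>S. a P \<noteq> 0"
      and a: "\<forall>k\<in>K. (\<Sum>P\<in>S. a P * P $$ k) = 0"
    using homogeneous_system_nontrivial_solution[of K S "\<lambda>k P. P $$ k"] fin
    by (auto simp: K_def)
  then obtain P where P: "P \<in> S" "a P \<noteq> 0" by blast
  define B where "B r c = (\<Sum>P\<in>S. a P * P $$ (r, c))" for r c
  have rows: "(\<Sum>c\<in>{0..<n}. B r c) = sum a S" if "r < n" for r
  proof -
    have "(\<Sum>c\<in>{0..<n}. B r c) = (\<Sum>P\<in>S. a P * (\<Sum>c\<in>{0..<n}. P $$ (r, c)))"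
      unfolding B_def by (subst sum.swap) (simp add: sum_distrib_left)
    also have "\<dots> = (\<Sum>P\<in>S. a P)"
      using assms(2) perm_mat_row_sum that by (intro sum.cong) (auto simp: perm_mats_def)
    finally show ?thesis .
  qed
  have cols: "(\<Sum>r\<in>{0..<n}. B r c) = sum a S" if "c < n" for c
  proof -
    have "(\<Sum>r\<in>{0..<n}. B r c) = (\<Sum>P\<in>S. a P * (\<Sum>r\<in>{0..<n}. P $$ (r, c)))"
      unfolding B_def by (subst sum.swap) (simp add: sum_distrib_left)
    also have "\<dots> = (\<Sum>P\<in>S. a P)"
      using assms(2) perm_mat_col_sum that by (intro sum.cong) (auto simp: perm_mats_def)
    finally show ?thesis .
  qed
  have corner: "B i j = 0" using un by (simp add: B_def)
  have minor: "B r c = 0" if "r < n" "c < n" "r \<noteq> i" "c \<noteq> j" for r c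
    using a that by (auto simp: B_def K_def)
  have "B r c = 0" if "r < n" "c < n" for r c
    by (rule constant_line_sums_eq_zero[where B = B and n = n, OF assms(1) ij rows cols corner minor that])
  moreover have "S \<subseteq> carrier_mat n n" using assms(2) by (auto simp: perm_mats_def perm_mat_def)
  ultimately show ?thesis
    using lin_dependent_matsI[of S n P a] fin P by (simp add: B_def)
qed

section \<open>Counting permutation matrices with prescribed zeros\<close>

lemma bij_betw_permutations_fixing:
  assumes "i \<in> A" "j \<in> A"
  shows "bij_betw (\<lambda>\<sigma>. Transposition.transpose i j \<circ> \<sigma>)
    {\<sigma>. \<sigma> permutes A \<and> \<sigma> i = j} {\<sigma>. \<sigma> permutes A - {i}}"
proof (rule bij_betw_byWitness[where f' = "\<lambda>\<sigma>. Transposition.transpose i j \<circ> \<sigma>"])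
  have tr: "Transposition.transpose i j permutes A" using assms by (simp add: permutes_swap_id)
  show "\<forall>\<sigma>\<in>{\<sigma>. \<sigma> permutes A \<and> \<sigma> i = j}.
      Transposition.transpose i j \<circ> (Transposition.transpose i j \<circ> \<sigma>) = \<sigma>"
    by (simp add: fun_eq_iff)
  show "\<forall>\<sigma>\<in>{\<sigma>. \<sigma> permutes A - {i}}.
      Transposition.transpose i j \<circ> (Transposition.transpose i j \<circ> \<sigma>) = \<sigma>"
    by (simp add: fun_eq_iff)
  show "(\<lambda>\<sigma>. Transposition.transpose i j \<circ> \<sigma>) ` {\<sigma>. \<sigma> permutes A \<and> \<sigma> i = j}
      \<subseteq> {\<sigma>. \<sigma> permutes A - {i}}"
  proof clarify
    fix \<sigma> assume \<sigma>: "\<sigma> permutes A" "j = \<sigma> i"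
    show "Transposition.transpose i (\<sigma> i) \<circ> \<sigma> permutes A - {i}"
      by (rule permutes_superset[of _ A]) (use \<sigma> tr in \<open>auto intro: permutes_compose\<close>)
  qed
  show "(\<lambda>\<sigma>. Transposition.transpose i j \<circ> \<sigma>) ` {\<sigma>. \<sigma> permutes A - {i}}
      \<subseteq> {\<sigma>. \<sigma> permutes A \<and> \<sigma> i = j}"
  proof clarify
    fix \<sigma> assume \<sigma>: "\<sigma> permutes A - {i}"
    have "\<sigma> i = i" using \<sigma> permutes_not_in by fastforce
    moreover have "\<sigma> permutes A" using \<sigma> permutes_subset[of \<sigma> "A - {i}" A] by blast
    ultimately show "Transposition.transpose i j \<circ> \<sigma> permutes A \<and>
        (Transposition.transpose i j \<circ> \<sigma>) i = j"
      using tr by (auto intro: permutes_compose)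
  qed
qed

lemma card_permutations_one_value:
  assumes "finite A" "i \<in> A" "j \<in> A"
  shows "card {\<sigma>. \<sigma> permutes A \<and> \<sigma> i = j} = fact (card A - 1)"
  using bij_betw_same_card[OF bij_betw_permutations_fixing[OF assms(2,3)]] assms
  by (simp add: card_permutations)

text \<open>The inequality is strict when \<open>i = k\<close> or \<open>j = l\<close>, where no such permutation exists.\<close>

lemma card_permutations_two_values_le:
  assumes "finite A" "i \<in> A" "j \<in> A" "k \<in> A" "l \<in> A" "(i, j) \<noteq> (k, l)"
  shows "card {\<sigma>. \<sigma> permutes A \<and> \<sigma> i = j \<and> \<sigma> k = l} \<le> fact (card A - 2)"
proof (cases "i = k \<or> j = l")
  case True
  have "\<sigma> i \<noteq> j \<or> \<sigma> k \<noteq> l" if "\<sigma> permutes A" for \<sigma>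
    using True assms(6) permutes_inj[OF that] by (auto dest: injD)
  then have empty: "{\<sigma>. \<sigma> permutes A \<and> \<sigma> i = j \<and> \<sigma> k = l} = {}" by blast
  show ?thesis unfolding empty by simp
next
  case False
  let ?t = "Transposition.transpose i j"
  have l': "?t l \<in> A - {i}"
    using False assms by (auto simp: Transposition.transpose_def)
  have "inj_on (\<lambda>\<sigma>. ?t \<circ> \<sigma>) {\<sigma>. \<sigma> permutes A \<and> \<sigma> i = j \<and> \<sigma> k = l}"
    by (rule inj_on_subset[OF bij_betw_imp_inj_on[OF bij_betw_permutations_fixing[OF assms(2,3)]]]) auto
  moreover have "(\<lambda>\<sigma>. ?t \<circ> \<sigma>) ` {\<sigma>. \<sigma> permutes A \<and> \<sigma> i = j \<and> \<sigma> k = l}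
      \<subseteq> {\<sigma>. \<sigma> permutes A - {i} \<and> \<sigma> k = ?t l}"
    using bij_betw_imp_surj_on[OF bij_betw_permutations_fixing[OF assms(2,3)]] by auto
  moreover have "finite {\<sigma>. \<sigma> permutes A - {i} \<and> \<sigma> k = ?t l}"
    using finite_permutations[of "A - {i}"] assms by simp
  ultimately have "card {\<sigma>. \<sigma> permutes A \<and> \<sigma> i = j \<and> \<sigma> k = l}
      \<le> card {\<sigma>. \<sigma> permutes A - {i} \<and> \<sigma> k = ?t l}"
    by (rule card_inj_on_le)
  also have "\<dots> = fact (card (A - {i}) - 1)"
    using False assms l' by (intro card_permutations_one_value) auto
  finally show ?thesis using assms by (simp add: numeral_2_eq_2)
qed

lemma card_filter_perm_mats:
  "card {P \<in> perm_mats n. R P} = card {\<sigma>. \<sigma> permutes {0..<n} \<and> R (perm_mat n \<sigma>)}"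
proof -
  have "{P \<in> perm_mats n. R P} = perm_mat n ` {\<sigma>. \<sigma> permutes {0..<n} \<and> R (perm_mat n \<sigma>)}"
    by (auto simp: perm_mats_def)
  then show ?thesis
    by (simp add: card_image[OF inj_on_subset[OF inj_on_perm_mat]] Collect_mono)
qed

lemma unoccupied_perm_mat: "i < n \<Longrightarrow> j < n \<Longrightarrow> unoccupied (perm_mat n \<sigma>) i j \<longleftrightarrow> \<sigma> i \<noteq> j"
  by (auto simp: unoccupied_def perm_mat_def)

lemma card_perm_mats_unoccupied:
  assumes "i < n" "j < n"
  shows "card {P \<in> perm_mats n. unoccupied P i j} = fact n - fact (n - 1)"
proof -
  have fin: "finite {\<sigma>. \<sigma> permutes {0..<n}}" by (simp add: finite_permutations)
  have "{\<sigma>. \<sigma> permutes {0..<n} \<and> \<sigma> i \<noteq> j}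
      = {\<sigma>. \<sigma> permutes {0..<n}} - {\<sigma>. \<sigma> permutes {0..<n} \<and> \<sigma> i = j}" by blast
  also have "card \<dots> = fact n - fact (n - 1)"
    using fin assms by (subst card_Diff_subset)
      (auto simp: card_permutations card_permutations_one_value)
  finally show ?thesis using assms by (simp add: card_filter_perm_mats unoccupied_perm_mat)
qed

lemma card_perm_mats_two_unoccupied_le:
  assumes "i < n" "j < n" "k < n" "l < n" "(i, j) \<noteq> (k, l)"
  shows "card {P \<in> perm_mats n. unoccupied P i j \<and> unoccupied P k l} + 2 * fact (n - 1)
    \<le> fact n + fact (n - 2)"
proof -
  let ?A = "{\<sigma>. \<sigma> permutes {0..<n}}"
  let ?X = "{\<sigma>. \<sigma> permutes {0..<n} \<and> \<sigma> i = j}" and ?Y = "{\<sigma>. \<sigma> permutes {0..<n} \<and> \<sigma> k = l}"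
  have fin: "finite ?A" by (simp add: finite_permutations)
  have sub: "?X \<union> ?Y \<subseteq> ?A" by blast
  then have finXY: "finite ?X" "finite ?Y" using fin finite_subset by auto
  have "{P. P permutes {0..<n} \<and> P i \<noteq> j \<and> P k \<noteq> l} = ?A - (?X \<union> ?Y)" by blast
  then have "card {P. P permutes {0..<n} \<and> P i \<noteq> j \<and> P k \<noteq> l} + card (?X \<union> ?Y) = fact n"
    using card_Diff_subset[OF finite_subset[OF sub fin] sub] card_mono[OF fin sub]
    by (simp add: card_permutations)
  moreover have "card ?X + card ?Y = card (?X \<union> ?Y) + card (?X \<inter> ?Y)"
    using finXY by (rule card_Un_Int)
  moreover have "?X \<inter> ?Y = {\<sigma>. \<sigma> permutes {0..<n} \<and> \<sigma> i = j \<and> \<sigma> k = l}" by blast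
  moreover have "card {\<sigma>. \<sigma> permutes {0..<n} \<and> \<sigma> i = j \<and> \<sigma> k = l} \<le> fact (n - 2)"
    using card_permutations_two_values_le[of "{0..<n}" i j k l] assms by simp
  moreover have "card ?X = fact (n - 1)" "card ?Y = fact (n - 1)"
    using assms card_permutations_one_value[of "{0..<n}"] by simp_all
  ultimately show ?thesis using assms by (simp add: card_filter_perm_mats unoccupied_perm_mat)
qed

section \<open>The probability that prescribed positions are unoccupied\<close>

lemma prob_random_perm_mats_all:
  "measure_pmf.prob (random_perm_mats n) {S. \<forall>P\<in>S. R P}
    = real (card {P \<in> perm_mats n. R P} choose num_mats n) / real (fact n choose num_mats n)"
proof -
  let ?\<Omega> = "{S. S \<subseteq> perm_mats n \<and> card S = num_mats n}"
  have fin: "finite ?\<Omega>" using finite_perm_mats by simp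
  have ne: "?\<Omega> \<noteq> {}"
    using set_pmf_random_perm_mats[of n] set_pmf_not_empty[of "random_perm_mats n"] by simp
  have "?\<Omega> \<inter> {S. \<forall>P\<in>S. R P} = {S. S \<subseteq> {P \<in> perm_mats n. R P} \<and> card S = num_mats n}" by blast
  then show ?thesis
    using finite_perm_mats
    by (simp add: random_perm_mats_def measure_pmf_of_set[OF ne fin] n_subsets card_perm_mats)
qed

lemma binomial_ratio_eq_prod:
  assumes "d \<le> m" "m \<le> N"
  shows "real (m choose d) / real (N choose d) = (\<Prod>i = 0..<d. real (m - i) / real (N - i))"
proof -
  have "real (m choose d) / real (N choose d)
      = (\<Prod>i = 0..<d. (real (m - i) / real (d - i)) / (real (N - i) / real (d - i)))"
    using assms by (simp add: binomial_altdef_of_nat prod_dividef)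
  also have "\<dots> = (\<Prod>i = 0..<d. real (m - i) / real (N - i))"
    by (intro prod.cong) auto
  finally show ?thesis .
qed

lemma binomial_ratio_le_power:
  assumes "m \<le> N"
  shows "real (m choose d) / real (N choose d) \<le> (real m / real N) ^ d"
proof (cases "d \<le> m")
  case True
  have "(\<Prod>i = 0..<d. real (m - i) / real (N - i)) \<le> (\<Prod>i = 0..<d. real m / real N)"
  proof (intro prod_mono conjI)
    fix i assume "i \<in> {0..<d}"
    then have "i < m" using True by simp
    have "real i * real m \<le> real i * real N" using assms by (intro mult_left_mono) auto
    then show "real (m - i) / real (N - i) \<le> real m / real N"
      using \<open>i < m\<close> assms by (simp add: divide_simps of_nat_diff algebra_simps)
  qed simp
  then show ?thesis using True assms by (simp add: binomial_ratio_eq_prod)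
qed (simp add: binomial_eq_0)

lemma binomial_ratio_ge:
  assumes "0 < m" "d \<le> m" "m \<le> N"
  shows "(real m / real N) ^ d * (1 - real d ^ 2 / real m) \<le> real (m choose d) / real (N choose d)"
proof -
  have "1 + real d * (- (real d / real m)) \<le> (1 + - (real d / real m)) ^ d"
    using assms by (intro Bernoulli_inequality) simp
  then have "(real m / real N) ^ d * (1 - real d ^ 2 / real m)
      \<le> (real m / real N) ^ d * (1 - real d / real m) ^ d"
    by (intro mult_left_mono) (simp_all add: power2_eq_square)
  also have "\<dots> = (real m / real N * (1 - real d / real m)) ^ d"
    by (rule power_mult_distrib[symmetric])
  also have "real m / real N * (1 - real d / real m) = (real m - real d) / real N"
    using assms by (simp add: field_simps)
  also have "((real m - real d) / real N) ^ d = (\<Prod>i = 0..<d. (real m - real d) / real N)" by simp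
  also have "\<dots> \<le> (\<Prod>i = 0..<d. real (m - i) / real (N - i))"
    using assms by (intro prod_mono) (auto intro!: frac_le)
  finally show ?thesis using assms by (simp add: binomial_ratio_eq_prod)
qed

section \<open>A Bonferroni inequality\<close>

text \<open>The correction term runs over ordered pairs, hence counts every unordered pair twice.\<close>

lemma (in finite_measure) bonferroni_lower_bound:
  assumes "finite Q" "\<And>q. q \<in> Q \<Longrightarrow> E q \<in> sets M"
  shows "(\<Sum>q\<in>Q. measure M (E q)) - (\<Sum>q\<in>Q. \<Sum>r\<in>Q. if q = r then 0 else measure M (E q \<inter> E r))
    \<le> measure M (\<Union>q\<in>Q. E q)"
  using assms
proof (induction Q rule: finite_induct)
  case (insert x Q)
  let ?U = "\<Union>q\<in>Q. E q"
  let ?f = "\<lambda>q r. if q = r then 0 else measure M (E q \<inter> E r)"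
  have sets: "E x \<in> sets M" "?U \<in> sets M" using insert by auto
  have "measure M (E x \<inter> ?U) = measure M (\<Union>q\<in>Q. E x \<inter> E q)"
    by (rule arg_cong[of _ _ "measure M"]) blast
  also have "\<dots> \<le> (\<Sum>q\<in>Q. measure M (E x \<inter> E q))"
    using insert by (intro finite_measure_subadditive_finite) auto
  also have "\<dots> = (\<Sum>q\<in>Q. ?f x q)" using insert by (intro sum.cong) auto
  finally have inter: "measure M (E x \<inter> ?U) \<le> (\<Sum>q\<in>Q. ?f x q)" .
  have "measure M (E x \<union> ?U) = measure M (E x) + measure M ?U - measure M (E x \<inter> ?U)"
    using finite_measure_Union'[OF sets] finite_measure_Diff'[OF sets(2,1)]
    by (simp add: Int_commute)
  moreover have "0 \<le> (\<Sum>q\<in>Q. ?f q x)" by (intro sum_nonneg) auto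
  moreover have "(\<Sum>q\<in>insert x Q. \<Sum>r\<in>insert x Q. ?f q r)
      = (\<Sum>r\<in>Q. ?f x r) + ((\<Sum>q\<in>Q. ?f q x) + (\<Sum>q\<in>Q. \<Sum>r\<in>Q. ?f q r))"
    using insert by (simp add: sum.distrib)
  ultimately show ?case using insert inter by simp
qed simp

section \<open>Asymptotics of the probability of an unoccupied position\<close>

text \<open>The expected number of unoccupied positions if the \<open>num_mats n\<close> matrices were drawn
  independently.\<close>

definition main_term :: "nat \<Rightarrow> real" where
  "main_term n = real n ^ 2 * (1 - 1 / real n) ^ num_mats n"

lemma main_term_pos: "n \<ge> 2 \<Longrightarrow> main_term n > 0"
  by (simp add: main_term_def)

lemma fact_minus_one_ratio:
  assumes "n \<ge> 1"
  shows "real (fact n - fact (n - 1)) / real (fact n) = 1 - 1 / real n"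
proof -
  have "fact (n - 1) \<le> (fact n :: nat)" by (rule fact_mono) simp
  moreover have "real (fact n) = real n * real (fact (n - 1))"
    using assms by (subst fact_reduce) simp_all
  ultimately show ?thesis using assms by (simp add: of_nat_diff field_simps)
qed

lemma prob_unoccupied_le:
  assumes "i < n" "j < n"
  shows "measure_pmf.prob (random_perm_mats n) {S. \<forall>P\<in>S. unoccupied P i j}
    \<le> (1 - 1 / real n) ^ num_mats n"
  using binomial_ratio_le_power[of "fact n - fact (n - 1)" "fact n" "num_mats n"] assms
    fact_minus_one_ratio[of n]
  by (simp add: prob_random_perm_mats_all card_perm_mats_unoccupied)

text \<open>The error term bounds \<open>d\<^sup>2/m\<close>, where \<open>d \<le> n\<^sup>2\<close> and \<open>m = n! - (n - 1)! \<ge> n!/2\<close>; the second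
  assumption ensures \<open>d \<le> m\<close>.\<close>

lemma prob_unoccupied_ge:
  assumes "i < n" "j < n" "n \<ge> 3" "2 * real n ^ 4 \<le> fact n"
  shows "(1 - 1 / real n) ^ num_mats n * (1 - 2 * real n ^ 4 / fact n)
    \<le> measure_pmf.prob (random_perm_mats n) {S. \<forall>P\<in>S. unoccupied P i j}"
proof -
  define m :: nat where "m = fact n - fact (n - 1)"
  have fact_n: "real (fact n) = real n * real (fact (n - 1))"
    using assms by (subst fact_reduce) simp_all
  have "fact (n - 1) \<le> (fact n :: nat)" by (rule fact_mono) simp
  then have "real m = real (fact n) - real (fact (n - 1))" by (simp add: m_def of_nat_diff)
  moreover have "2 * real (fact (n - 1)) \<le> real n * real (fact (n - 1))"
    using assms by (intro mult_right_mono) auto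
  ultimately have m_ge: "real (fact n) / 2 \<le> real m" using fact_n by simp
  then have m_pos: "0 < m" using fact_gt_zero[of n, where 'a = real] by (cases "m = 0") auto
  have "num_mats n \<le> n\<^sup>2"
    using assms by (cases n) (auto simp: num_mats_def power2_eq_square)
  then have d_le: "real (num_mats n) \<le> real n ^ 2"
    by (metis of_nat_le_iff of_nat_power)
  have "real n ^ 2 \<le> real n ^ 4" using assms by (intro power_increasing) auto
  then have "real (num_mats n) \<le> real m" using d_le m_ge assms(4) unfolding of_nat_fact by linarith
  then have d_le_m: "num_mats n \<le> m" by simp
  have "real (num_mats n) ^ 2 \<le> (real n ^ 2) ^ 2" using d_le by (intro power_mono) auto
  then have "real (num_mats n) ^ 2 / real m \<le> real n ^ 4 / (real (fact n) / 2)"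
    using m_ge m_pos by (intro frac_le) (auto simp flip: power_mult)
  then have "(1 - 1 / real n) ^ num_mats n * (1 - 2 * real n ^ 4 / fact n)
      \<le> (1 - 1 / real n) ^ num_mats n * (1 - real (num_mats n) ^ 2 / real m)"
    using assms by (intro mult_left_mono) (auto simp: field_simps)
  also have "\<dots> \<le> real (m choose num_mats n) / real (fact n choose num_mats n)"
    using binomial_ratio_ge[OF m_pos d_le_m, of "fact n"] fact_minus_one_ratio[of n] assms
    by (simp add: m_def)
  finally show ?thesis
    using assms by (simp add: prob_random_perm_mats_all card_perm_mats_unoccupied m_def)
qed

lemma prob_two_unoccupied_le:
  assumes "i < n" "j < n" "k < n" "l < n" "(i, j) \<noteq> (k, l)" "n \<ge> 3"
  shows "measure_pmf.prob (random_perm_mats n)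
      ({S. \<forall>P\<in>S. unoccupied P i j} \<inter> {S. \<forall>P\<in>S. unoccupied P k l})
    \<le> (1 - 1 / real n) ^ num_mats n * exp (- (real n - 2))"
proof -
  define f where "f = real (fact (n - 2))"
  define m where "m = card {P \<in> perm_mats n. unoccupied P i j \<and> unoccupied P k l}"
  define d where "d = num_mats n"
  have f: "f > 0" by (simp add: f_def)
  have fact1: "real (fact (n - 1)) = (real n - 1) * f"
    using assms by (subst fact_reduce) (simp_all add: f_def of_nat_diff numeral_2_eq_2)
  have fact0: "real (fact n) = real n * (real n - 1) * f"
    using assms fact1 by (subst fact_reduce) simp_all
  have m_le: "m \<le> fact n"
    unfolding m_def card_perm_mats[symmetric] using finite_perm_mats by (intro card_mono) auto
  have "real m + 2 * real (fact (n - 1)) \<le> real (fact n) + real (fact (n - 2))"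
    using card_perm_mats_two_unoccupied_le[OF assms(1-5)] unfolding m_def
    by (metis (no_types, lifting) of_nat_add of_nat_le_iff of_nat_mult of_nat_numeral)
  then have "real m \<le> (real n * (real n - 1) + 1 - 2 * (real n - 1)) * f"
    unfolding fact0 fact1 f_def[symmetric] by (simp add: algebra_simps)
  then have "real m / real (fact n) \<le>
      (real n * (real n - 1) + 1 - 2 * (real n - 1)) * f / (real n * (real n - 1) * f)"
    unfolding fact0 using f assms by (intro divide_right_mono) auto
  also have "\<dots> = (real n * (real n - 1) + 1 - 2 * (real n - 1)) / (real n * (real n - 1))"
    using f by simp
  also have "\<dots> = (1 - 1 / real n) * (1 - (real n - 2) / (real n - 1) ^ 2)"
    using assms by (simp add: divide_simps) (simp add: algebra_simps power2_eq_square)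
  also have "\<dots> \<le> (1 - 1 / real n) * exp (- ((real n - 2) / (real n - 1) ^ 2))"
    using assms exp_ge_add_one_self[of "- ((real n - 2) / (real n - 1) ^ 2)"]
    by (intro mult_left_mono) auto
  finally have ratio: "real m / real (fact n)
      \<le> (1 - 1 / real n) * exp (- ((real n - 2) / (real n - 1) ^ 2))" .
  \<comment> \<open>As \<open>d \<ge> (n - 1)\<^sup>2\<close>, the \<open>d\<close>-th power of the exponential factor is at most \<open>exp (- (n - 2))\<close>.\<close>
  have d_ge: "(real n - 1) ^ 2 \<le> real d"
    using assms by (simp add: d_def num_mats_def of_nat_diff)
  have "(real n - 2) = (real n - 1) ^ 2 * ((real n - 2) / (real n - 1) ^ 2)"
    using assms by simp
  also have "\<dots> \<le> real d * ((real n - 2) / (real n - 1) ^ 2)"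
    using d_ge assms by (intro mult_right_mono) auto
  finally have expo: "real n - 2 \<le> real d * ((real n - 2) / (real n - 1) ^ 2)" .
  have "{S. \<forall>P\<in>S. unoccupied P i j} \<inter> {S. \<forall>P\<in>S. unoccupied P k l}
      = {S. \<forall>P\<in>S. unoccupied P i j \<and> unoccupied P k l}" by blast
  then have "measure_pmf.prob (random_perm_mats n)
      ({S. \<forall>P\<in>S. unoccupied P i j} \<inter> {S. \<forall>P\<in>S. unoccupied P k l})
    = real (m choose d) / real (fact n choose d)"
    by (simp add: prob_random_perm_mats_all m_def d_def)
  also have "\<dots> \<le> (real m / real (fact n)) ^ d" using m_le by (rule binomial_ratio_le_power)
  also have "\<dots> \<le> ((1 - 1 / real n) * exp (- ((real n - 2) / (real n - 1) ^ 2))) ^ d"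
    using ratio by (intro power_mono) auto
  also have "\<dots> = (1 - 1 / real n) ^ d * exp (- (real d * ((real n - 2) / (real n - 1) ^ 2)))"
    by (simp add: power_mult_distrib flip: exp_of_nat_mult)
  also have "\<dots> \<le> (1 - 1 / real n) ^ d * exp (- (real n - 2))"
    using expo assms by (intro mult_left_mono) auto
  finally show ?thesis by (simp add: d_def)
qed

lemma has_unoccupied_position_eq_UN:
  "{S. has_unoccupied_position n S}
    = (\<Union>q\<in>{0..<n} \<times> {0..<n}. {S. \<forall>P\<in>S. unoccupied P (fst q) (snd q)})"
  by (force simp: has_unoccupied_position_def)

lemma prob_has_unoccupied_position_le:
  "measure_pmf.prob (random_perm_mats n) {S. has_unoccupied_position n S} \<le> main_term n"
proof -
  have "measure_pmf.prob (random_perm_mats n) {S. has_unoccupied_position n S}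
      \<le> (\<Sum>q\<in>{0..<n} \<times> {0..<n}.
          measure_pmf.prob (random_perm_mats n) {S. \<forall>P\<in>S. unoccupied P (fst q) (snd q)})"
    unfolding has_unoccupied_position_eq_UN
    by (intro measure_pmf.finite_measure_subadditive_finite) auto
  also have "\<dots> \<le> (\<Sum>q\<in>{0..<n} \<times> {0..<n}. (1 - 1 / real n) ^ num_mats n)"
    by (intro sum_mono prob_unoccupied_le) auto
  finally show ?thesis by (simp add: main_term_def power2_eq_square)
qed

lemma prob_has_unoccupied_position_ge:
  assumes "n \<ge> 3" "2 * real n ^ 4 \<le> fact n"
  shows "main_term n * (1 - 2 * real n ^ 4 / fact n - real n ^ 2 * exp (- (real n - 2)))
    \<le> measure_pmf.prob (random_perm_mats n) {S. has_unoccupied_position n S}"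
proof -
  let ?Q = "{0..<n} \<times> {0..<n}" and ?x = "(1 - 1 / real n) ^ num_mats n"
  let ?E = "\<lambda>q. {S. \<forall>P\<in>S. unoccupied P (fst q) (snd q)}"
  let ?p = "measure_pmf.prob (random_perm_mats n)"
  have "main_term n * (1 - 2 * real n ^ 4 / fact n)
      = (\<Sum>q\<in>?Q. ?x * (1 - 2 * real n ^ 4 / fact n))"
    by (simp add: main_term_def power2_eq_square)
  also have "\<dots> \<le> (\<Sum>q\<in>?Q. ?p (?E q))"
    using assms by (intro sum_mono prob_unoccupied_ge) auto
  finally have first: "main_term n * (1 - 2 * real n ^ 4 / fact n) \<le> (\<Sum>q\<in>?Q. ?p (?E q))" .
  have "(\<Sum>q\<in>?Q. \<Sum>r\<in>?Q. if q = r then 0 else ?p (?E q \<inter> ?E r))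
      \<le> (\<Sum>q\<in>?Q. \<Sum>r\<in>?Q. ?x * exp (- (real n - 2)))"
  proof (intro sum_mono)
    fix q r assume "q \<in> ?Q" "r \<in> ?Q"
    then show "(if q = r then 0 else ?p (?E q \<inter> ?E r)) \<le> ?x * exp (- (real n - 2))"
      using prob_two_unoccupied_le[of "fst q" n "snd q" "fst r" "snd r"] assms(1)
      by (cases "q = r") auto
  qed
  also have "\<dots> = main_term n * (real n ^ 2 * exp (- (real n - 2)))"
    by (simp add: main_term_def power2_eq_square)
  finally have second: "(\<Sum>q\<in>?Q. \<Sum>r\<in>?Q. if q = r then 0 else ?p (?E q \<inter> ?E r))
      \<le> main_term n * (real n ^ 2 * exp (- (real n - 2)))" .
  have "(\<Sum>q\<in>?Q. ?p (?E q)) - (\<Sum>q\<in>?Q. \<Sum>r\<in>?Q. if q = r then 0 else ?p (?E q \<inter> ?E r))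
      \<le> ?p (\<Union>q\<in>?Q. ?E q)"
    by (rule measure_pmf.bonferroni_lower_bound) auto
  then show ?thesis using first second
    by (simp add: has_unoccupied_position_eq_UN right_diff_distrib)
qed

lemma prob_lin_dependent_ge:
  assumes "n \<ge> 3"
  shows "measure_pmf.prob (random_perm_mats n) {S. has_unoccupied_position n S}
    \<le> measure_pmf.prob (random_perm_mats n) {S. lin_dependent_mats n S}"
proof (rule measure_pmf.finite_measure_mono_AE)
  show "AE S in random_perm_mats n. S \<in> {S. has_unoccupied_position n S}
      \<longrightarrow> S \<in> {S. lin_dependent_mats n S}"
    unfolding AE_measure_pmf_iff set_pmf_random_perm_mats
    using lin_dependent_mats_if_has_unoccupied_position[OF assms] by blast
qed simp

lemma power4_over_fact_tendsto_0: "(\<lambda>n. 2 * real n ^ 4 / fact n) \<longlonglongrightarrow> 0"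
proof -
  have "(\<lambda>n. 2 * real n ^ 4 / 2 ^ n) \<longlonglongrightarrow> 0" by real_asymp
  moreover have "(\<lambda>n. inverse (fact n) * 2 ^ n :: real) \<longlonglongrightarrow> 0"
    by (rule summable_LIMSEQ_zero[OF summable_exp])
  ultimately have "(\<lambda>n. 2 * real n ^ 4 / 2 ^ n * (inverse (fact n) * 2 ^ n)) \<longlonglongrightarrow> 0 * 0"
    by (rule tendsto_mult)
  then show ?thesis by (simp add: field_simps)
qed

lemma prob_over_main_term_tendsto:
  "(\<lambda>n. measure_pmf.prob (random_perm_mats n) {S. has_unoccupied_position n S} / main_term n)
    \<longlonglongrightarrow> 1"
proof (rule tendsto_sandwich)
  have "\<forall>\<^sub>F n in sequentially. 2 * real n ^ 4 / fact n < 1"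
    using power4_over_fact_tendsto_0 by (rule order_tendstoD) simp
  then have ev: "\<forall>\<^sub>F n in sequentially. n \<ge> 3 \<and> 2 * real n ^ 4 \<le> fact n"
    using eventually_ge_at_top[of "3::nat"]
    by eventually_elim (simp add: pos_divide_less_eq)
  show "\<forall>\<^sub>F n in sequentially. 1 - 2 * real n ^ 4 / fact n - real n ^ 2 * exp (- (real n - 2))
      \<le> measure_pmf.prob (random_perm_mats n) {S. has_unoccupied_position n S} / main_term n"
    using ev
  proof eventually_elim
    case (elim n)
    then show ?case
      using prob_has_unoccupied_position_ge[of n] main_term_pos[of n]
      by (simp add: pos_le_divide_eq mult.commute)
  qed
  show "\<forall>\<^sub>F n in sequentially.
      measure_pmf.prob (random_perm_mats n) {S. has_unoccupied_position n S} / main_term n \<le> 1"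
    using eventually_ge_at_top[of 2]
  proof eventually_elim
    case (elim n)
    then show ?case
      using prob_has_unoccupied_position_le[of n] main_term_pos[of n] by simp
  qed
  have "(\<lambda>n. real n ^ 2 * exp (- (real n - 2))) \<longlonglongrightarrow> 0" by real_asymp
  then have "(\<lambda>n. 1 - 2 * real n ^ 4 / fact n - real n ^ 2 * exp (- (real n - 2))) \<longlonglongrightarrow> 1 - 0 - 0"
    by (intro tendsto_diff tendsto_const power4_over_fact_tendsto_0)
  then show "(\<lambda>n. 1 - 2 * real n ^ 4 / fact n - real n ^ 2 * exp (- (real n - 2))) \<longlonglongrightarrow> 1"
    by simp
qed simp

text \<open>Since \<open>ln (1 - 1/n) = - 1/n - 1/(2 n\<^sup>2) + O(1/n\<^sup>3)\<close> and \<open>num_mats n = n\<^sup>2 - 2 n + 2\<close>, the exponent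
  is \<open>- n + 2 - 1/2 + o(1)\<close>; this is where the constant \<open>3/2\<close> comes from.\<close>

lemma num_mats_ln_tendsto:
  "(\<lambda>n. real (num_mats n) * ln (1 - 1 / real n) + real n - 3 / 2) \<longlonglongrightarrow> 0"
proof (rule Lim_transform_eventually)
  show "(\<lambda>n. ((real n - 1) ^ 2 + 1) * ln (1 - 1 / real n) + real n - 3 / 2) \<longlonglongrightarrow> 0"
    by real_asymp
  show "\<forall>\<^sub>F n in sequentially. ((real n - 1) ^ 2 + 1) * ln (1 - 1 / real n) + real n - 3 / 2
      = real (num_mats n) * ln (1 - 1 / real n) + real n - 3 / 2"
    using eventually_ge_at_top[of 1]
    by eventually_elim (simp add: num_mats_def of_nat_diff)
qed

lemma main_term_eq:
  assumes "n \<ge> 2"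
  shows "main_term n = exp (3 / 2 + (real (num_mats n) * ln (1 - 1 / real n) + real n - 3 / 2))
    * real n ^ 2 * exp (- real n)"
proof -
  have "(1 - 1 / real n) ^ num_mats n = exp (real (num_mats n) * ln (1 - 1 / real n))"
    using assms by (simp add: exp_of_nat_mult)
  also have "\<dots> = exp (3 / 2 + (real (num_mats n) * ln (1 - 1 / real n) + real n - 3 / 2)) * exp (- real n)"
    by (simp flip: exp_add)
  finally show ?thesis by (simp add: main_term_def)
qed

theorem proposition7p1:
  shows "(\<exists>\<epsilon> :: nat \<Rightarrow> real. \<epsilon> \<in> o(\<lambda>_. 1) \<and>
           (\<forall>\<^sub>F n in sequentially.
              measure_pmf.prob (random_perm_mats n) {S. lin_dependent_mats n S}
                \<ge> exp (3 / 2 + \<epsilon> n) * real n ^ 2 * exp (- real n)))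
       \<and> (\<exists>\<delta> \<eta> :: nat \<Rightarrow> real. \<delta> \<in> o(\<lambda>_. 1) \<and> \<eta> \<in> o(\<lambda>_. 1) \<and>
           (\<forall>\<^sub>F n in sequentially.
              measure_pmf.prob (random_perm_mats n) {S. has_unoccupied_position n S}
                = (1 + \<delta> n) * real n ^ 2 * (1 - 1 / real n) ^ num_mats n
            \<and> (1 + \<delta> n) * real n ^ 2 * (1 - 1 / real n) ^ num_mats n
                = exp (3 / 2 + \<eta> n) * real n ^ 2 * exp (- real n)))"
proof -
  define p where "p n = measure_pmf.prob (random_perm_mats n) {S. has_unoccupied_position n S}" for n
  define \<delta> where "\<delta> n = p n / main_term n - 1" for n
  define \<eta> where
    "\<eta> n = ln (1 + \<delta> n) + (real (num_mats n) * ln (1 - 1 / real n) + real n - 3 / 2)" for n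
  have "(\<lambda>n. p n / main_term n - 1) \<longlonglongrightarrow> 1 - 1"
    unfolding p_def by (intro tendsto_diff tendsto_const prob_over_main_term_tendsto)
  then have \<delta>_lim: "\<delta> \<longlonglongrightarrow> 0" by (simp add: \<delta>_def[abs_def])
  have "(\<lambda>n. ln (1 + \<delta> n)) \<longlonglongrightarrow> ln (1 + 0)"
    by (intro tendsto_ln tendsto_add tendsto_const \<delta>_lim) simp
  then have \<eta>_lim: "\<eta> \<longlonglongrightarrow> 0"
    unfolding \<eta>_def[abs_def] using tendsto_add[OF _ num_mats_ln_tendsto] by fastforce
  have o_\<delta>: "\<delta> \<in> o(\<lambda>_. 1)" and o_\<eta>: "\<eta> \<in> o(\<lambda>_. 1)"
    using \<delta>_lim \<eta>_lim by (auto intro: smalloI_tendsto)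
  have "\<forall>\<^sub>F n in sequentially. - 1 < \<delta> n" using \<delta>_lim by (rule order_tendstoD) simp
  then have ev: "\<forall>\<^sub>F n in sequentially. n \<ge> 3 \<and> p n = (1 + \<delta> n) * main_term n
      \<and> (1 + \<delta> n) * main_term n = exp (3 / 2 + \<eta> n) * real n ^ 2 * exp (- real n)"
    using eventually_ge_at_top[of 3]
  proof eventually_elim
    case (elim n)
    have "p n = (1 + \<delta> n) * main_term n" using main_term_pos[of n] elim by (simp add: \<delta>_def)
    moreover have "exp (3 / 2 + \<eta> n) = (1 + \<delta> n) *
        exp (3 / 2 + (real (num_mats n) * ln (1 - 1 / real n) + real n - 3 / 2))"
      using elim by (simp add: \<eta>_def exp_add)
    ultimately show ?case using elim main_term_eq[of n] by simp
  qed
  show ?thesis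
  proof (rule conjI[OF exI[of _ \<eta>] exI[of _ \<delta>, OF exI[of _ \<eta>]]]; intro conjI o_\<delta> o_\<eta>)
    show "\<forall>\<^sub>F n in sequentially. exp (3 / 2 + \<eta> n) * real n ^ 2 * exp (- real n)
        \<le> measure_pmf.prob (random_perm_mats n) {S. lin_dependent_mats n S}"
      using ev
    proof eventually_elim
      case (elim n)
      then show ?case using prob_lin_dependent_ge[of n] by (simp add: p_def)
    qed
    show "\<forall>\<^sub>F n in sequentially.
        measure_pmf.prob (random_perm_mats n) {S. has_unoccupied_position n S}
          = (1 + \<delta> n) * real n ^ 2 * (1 - 1 / real n) ^ num_mats n
        \<and> (1 + \<delta> n) * real n ^ 2 * (1 - 1 / real n) ^ num_mats n
          = exp (3 / 2 + \<eta> n) * real n ^ 2 * exp (- real n)"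
      using ev
    proof eventually_elim
      case (elim n)
      then show ?case unfolding p_def main_term_def mult.assoc by blast
    qed
  qed
qed

end
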